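(* Let $H$ be a collection of probability measures on a measurable space $(\mathcal{X},\mathcal{F})$ and let $\alpha>0$. Let $\phi_1,\phi_2:\mathcal{X}\to[0,1]$ be $\mathcal{F}$-measurable tests. Suppose that $\phi_1$ is valid for $H$ at level $\alpha$ and that $\phi_2$ is conditionally valid at conditional level $\phi_1$, i.e. $\mathbb{E}^{\mathbb{P}}[\phi_2\mid\phi_1]\le\phi_1$ ($\mathbb{P}$-almost surely) for every $\mathbb{P}\in H$. Then $\phi_2$ is valid for $H$ at level $\alpha$.
   Context: A test $\phi$ is valid for $H$ at level $\alpha$ if $\sup_{\mathbb{P}\in H}\mathbb{E}^{\mathbb{P}}[\phi]\le\alpha$. *)

theory Defs
  imports "HOL-Probability.Probability"
begin

text \<open>Throughout, the measurable space is given by the space and sets of \<open>M\<close>; the measure carried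
  by \<open>M\<close> plays no role.\<close>

definition is_test :: "'a measure \<Rightarrow> ('a \<Rightarrow> real) \<Rightarrow> bool" where
  "is_test M \<phi> \<longleftrightarrow> \<phi> \<in> borel_measurable M \<and> (\<forall>x\<in>space M. 0 \<le> \<phi> x \<and> \<phi> x \<le> 1)"

text \<open>The supremum is taken in \<open>ereal\<close>, where it exists also for an empty hypothesis.\<close>

definition valid_test :: "'a measure set \<Rightarrow> real \<Rightarrow> ('a \<Rightarrow> real) \<Rightarrow> bool" where
  "valid_test H \<alpha> \<phi> \<longleftrightarrow> (SUP P\<in>H. ereal (\<integral>x. \<phi> x \<partial>P)) \<le> ereal \<alpha>"

text \<open>Conditioning on the random variable \<open>\<psi>\<close> means conditioning on the sigma-algebra it generates.\<close>

definition conditionally_valid_test ::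
    "'a measure set \<Rightarrow> ('a \<Rightarrow> real) \<Rightarrow> ('a \<Rightarrow> real) \<Rightarrow> bool" where
  "conditionally_valid_test H \<psi> \<phi> \<longleftrightarrow>
     (\<forall>P\<in>H. AE x in P. real_cond_exp P (vimage_algebra (space P) \<psi> borel) \<phi> x \<le> \<psi> x)"

end

theory Submission
  imports Defs
begin

text \<open>Under each \<open>P\<close> in the hypothesis, the tower property and monotonicity of the integral give
  \<open>E[\<phi>\<^sub>2] = E[E[\<phi>\<^sub>2 | \<phi>\<^sub>1]] \<le> E[\<phi>\<^sub>1]\<close>. Validity bounds the supremum of the
  right-hand side over the hypothesis by \<open>\<alpha>\<close>, hence also that of the left-hand side.\<close>

lemma subalgebra_vimage_algebra:
  assumes "f \<in> measurable M N"
  shows "subalgebra M (vimage_algebra (space M) f N)"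
  using assms unfolding subalgebra_def
  by (auto simp: sets_vimage_algebra2 measurable_space)

lemma (in prob_space) integrable_test:
  assumes "is_test N f" "sets M = sets N"
  shows "integrable M f"
proof (rule integrable_const_bound[where B = 1])
  show "f \<in> borel_measurable M"
    using assms by (simp add: is_test_def cong: measurable_cong_sets)
  show "AE x in M. norm (f x) \<le> 1"
    using assms sets_eq_imp_space_eq[OF assms(2)] by (auto simp: is_test_def)
qed

text \<open>The tower property enters here: integrating the conditional expectation gives back the
  unconditional one, so an almost sure bound on the former bounds the latter in mean.\<close>

lemma (in finite_measure_subalgebra) integral_le_of_real_cond_exp_le:
  assumes "integrable M f" "integrable M g"
    and "AE x in M. real_cond_exp M F f x \<le> g x"
  shows "(\<integral>x. f x \<partial>M) \<le> (\<integral>x. g x \<partial>M)"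
proof -
  have "(\<integral>x. f x \<partial>M) = (\<integral>x. real_cond_exp M F f x \<partial>M)"
    using real_cond_exp_int(2)[OF assms(1)] by simp
  also have "\<dots> \<le> (\<integral>x. g x \<partial>M)"
    using real_cond_exp_int(1)[OF assms(1)] assms(2,3) by (rule integral_mono_AE)
  finally show ?thesis .
qed

theorem theorem4:
  fixes M :: "'a measure" and H :: "'a measure set" and \<alpha> :: real
    and \<phi>\<^sub>1 \<phi>\<^sub>2 :: "'a \<Rightarrow> real"
  assumes "\<And>P. P \<in> H \<Longrightarrow> prob_space P"
    and "\<And>P. P \<in> H \<Longrightarrow> sets P = sets M"
    and "\<alpha> > 0"
    and "is_test M \<phi>\<^sub>1"
    and "is_test M \<phi>\<^sub>2"
    and "valid_test H \<alpha> \<phi>\<^sub>1"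
    and "conditionally_valid_test H \<phi>\<^sub>1 \<phi>\<^sub>2"
  shows "valid_test H \<alpha> \<phi>\<^sub>2"
proof -
  have "(\<integral>x. \<phi>\<^sub>2 x \<partial>P) \<le> (\<integral>x. \<phi>\<^sub>1 x \<partial>P)" if P: "P \<in> H" for P
  proof -
    interpret prob_space P
      using assms(1) P .
    have int: "integrable P \<phi>\<^sub>1" "integrable P \<phi>\<^sub>2"
      using integrable_test assms(2,4,5) P by blast+
    interpret finite_measure_subalgebra P "vimage_algebra (space P) \<phi>\<^sub>1 borel"
      using subalgebra_vimage_algebra int(1) by unfold_locales auto
    show ?thesis
      using int assms(7) P
      by (intro integral_le_of_real_cond_exp_le) (auto simp: conditionally_valid_test_def)
  qed
  then have "(SUP P\<in>H. ereal (\<integral>x. \<phi>\<^sub>2 x \<partial>P)) \<le> (SUP P\<in>H. ereal (\<integral>x. \<phi>\<^sub>1 x \<partial>P))"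
    by (intro SUP_mono) auto
  with assms(6) show ?thesis
    unfolding valid_test_def by (rule order_trans[rotated])
qed

end
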